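(* Let $\mu>0$ and let $F$ be a differentiable strongly exponentially general convex function (with constant $\mu$) on the general convex set $K_g$. Then $$\langle e^{F(g(u))}F'(g(u))-e^{F(g(v))}F'(g(v)),\,g(u)-g(v)\rangle\ge 2\mu\,\|g(v)-g(u)\|^2\qquad\text{for all } g(u),g(v)\in K_g .$$
   Context: $H$ is a real Hilbert space with inner product $\langle\cdot,\cdot\rangle$ and norm $\|\cdot\|$, and $g:H\to H$ is an arbitrary function. $K_g\subseteq H$ is a general convex set with respect to $g$: $g(u)+t(g(v)-g(u))\in K_g$ for all $u,v\in H$ with $g(u),g(v)\in K_g$ and all $t\in[0,1]$. As a standing assumption $g$ is onto $K_g$ (every point of $K_g$ is $g(v)$ for some $v\in H$). "For all $g(u),g(v)\in K_g$" means for all $u,v\in H$ with $g(u),g(v)\in K_g$. A positive real-valued function $F$ on $K_g$ is strongly exponentially general convex with constant $\mu>0$ if $$e^{F(g(u)+t(g(v)-g(u)))}\le(1-t)e^{F(g(u))}+te^{F(g(v))}-\mu\,t(1-t)\,\|g(v)-g(u)\|^2$$ for all $g(u),g(v)\in K_g$ and $t\in[0,1]$. "Differentiable" means Fréchet differentiable at the points of $K_g$ ($F$ being understood as defined near $K_g$), with $F'$ identified with an element of $H$. *)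

theory Defs
  imports "HOL-Analysis.Analysis"
begin

definition general_convex_set :: "('a::real_inner \<Rightarrow> 'a) \<Rightarrow> 'a set \<Rightarrow> bool" where
  "general_convex_set g K \<longleftrightarrow>
     (\<forall>u v. g u \<in> K \<longrightarrow> g v \<in> K \<longrightarrow>
        (\<forall>t\<in>{0..1}. g u + t *\<^sub>R (g v - g u) \<in> K))"

text \<open>\<open>F\<close> is a total function, but only its values on \<open>K\<close> matter here.\<close>

definition strongly_exp_general_convex ::
  "real \<Rightarrow> ('a::real_inner \<Rightarrow> 'a) \<Rightarrow> 'a set \<Rightarrow> ('a \<Rightarrow> real) \<Rightarrow> bool" where
  "strongly_exp_general_convex \<mu> g K F \<longleftrightarrow>
     \<mu> > 0 \<and> (\<forall>x\<in>K. F x > 0) \<and>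
     (\<forall>u v. g u \<in> K \<longrightarrow> g v \<in> K \<longrightarrow>
        (\<forall>t\<in>{0..1}.
           exp (F (g u + t *\<^sub>R (g v - g u)))
             \<le> (1 - t) * exp (F (g u)) + t * exp (F (g v))
                - \<mu> * t * (1 - t) * (norm (g v - g u))\<^sup>2))"

end

theory Submission
  imports Defs
begin

text \<open>
  Put \<open>G = exp \<circ> F\<close>. The hypothesis says that \<open>G\<close> is strongly convex with modulus \<open>\<mu>\<close> along
  every segment between points of \<open>K\<close>, and by the chain rule \<open>G\<close> has gradient
  \<open>exp (F x) *\<^sub>R F' x\<close> at \<open>x\<close>. Dividing the strong convexity inequality by \<open>t\<close> and letting
  \<open>t\<close> tend to \<open>0\<close> from the right gives the gradient inequality, in which \<open>G\<close> lies above its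
  tangent at \<open>x\<close> by at least \<open>\<mu> * (norm (y - x))\<^sup>2\<close>. Adding the gradient inequalities for
  \<open>(x, y)\<close> and \<open>(y, x)\<close> cancels the values of \<open>G\<close>; the two quadratic terms add up and yield
  the factor \<open>2\<close>.
\<close>

text \<open>
  By strong convexity the difference quotient of \<open>G\<close> at \<open>x\<close> in direction \<open>y - x\<close> with step \<open>t\<close> is
  at most \<open>G y - G x - \<mu> * (1 - t) * (norm (y - x))\<^sup>2\<close>, and both sides converge as \<open>t\<close> decreases
  to \<open>0\<close>.
\<close>
lemma strong_convexity_gradient_inequality:
  fixes G :: "'a::real_inner \<Rightarrow> real"
  assumes grad: "GDERIV G x :> d"
    and convex: "\<And>t. t \<in> {0<..<1} \<Longrightarrow>
      G (x + t *\<^sub>R (y - x)) \<le> (1 - t) * G x + t * G y - \<mu> * t * (1 - t) * (norm (y - x))\<^sup>2"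
  shows "inner d (y - x) \<le> G y - G x - \<mu> * (norm (y - x))\<^sup>2"
proof -
  define \<phi> where "\<phi> t = G (x + t *\<^sub>R (y - x))" for t :: real
  have "((\<lambda>t::real. x + t *\<^sub>R (y - x)) has_derivative (\<lambda>t. t *\<^sub>R (y - x))) (at 0)"
    by (auto intro!: derivative_eq_intros)
  moreover have "(G has_derivative (\<lambda>h. inner h d)) (at (x + (0::real) *\<^sub>R (y - x)))"
    using grad by (simp add: gderiv_def)
  ultimately have "(\<phi> has_derivative (\<lambda>t. inner (t *\<^sub>R (y - x)) d)) (at 0)"
    unfolding \<phi>_def by (rule has_derivative_compose)
  then have "(\<phi> has_field_derivative inner d (y - x)) (at 0)"
    by (simp add: has_field_derivative_def inner_commute mult.commute[of _ "inner _ _"])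
  then have quotient: "((\<lambda>t. (\<phi> t - \<phi> 0) / t) \<longlongrightarrow> inner d (y - x)) (at_right 0)"
    by (auto simp: DERIV_def intro: filterlim_mono[OF _ order_refl at_le])
  have bound: "((\<lambda>t. G y - G x - \<mu> * (1 - t) * (norm (y - x))\<^sup>2)
      \<longlongrightarrow> G y - G x - \<mu> * (1 - 0) * (norm (y - x))\<^sup>2) (at_right 0)"
    by (intro tendsto_intros)
  have "(\<phi> t - \<phi> 0) / t \<le> G y - G x - \<mu> * (1 - t) * (norm (y - x))\<^sup>2"
    if "t \<in> {0<..<1}" for t
  proof -
    have "\<phi> t - \<phi> 0 \<le> (G y - G x - \<mu> * (1 - t) * (norm (y - x))\<^sup>2) * t"
      using convex[OF that] by (simp add: \<phi>_def algebra_simps)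
    then show ?thesis
      using that by (simp only: pos_divide_le_eq greaterThanLessThan_iff)
  qed
  then have "\<forall>\<^sub>F t in at_right 0.
      (\<phi> t - \<phi> 0) / t \<le> G y - G x - \<mu> * (1 - t) * (norm (y - x))\<^sup>2"
    by (intro eventually_at_rightI[of 0 1]) simp_all
  from tendsto_le[OF _ bound quotient this] show ?thesis
    by simp
qed

theorem theorem30:
  fixes g :: "'a::{real_inner, complete_space} \<Rightarrow> 'a"
    and K :: "'a set"
    and F :: "'a \<Rightarrow> real"
    and F' :: "'a \<Rightarrow> 'a"
    and \<mu> :: real
  assumes mu_pos: "\<mu> > 0"
    and K_convex: "general_convex_set g K"
    and g_onto: "K \<subseteq> range g"
    and F_convex: "strongly_exp_general_convex \<mu> g K F"
    and F_diff: "\<forall>x\<in>K. GDERIV F x :> F' x"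
  shows "\<forall>u v. g u \<in> K \<longrightarrow> g v \<in> K \<longrightarrow>
           inner (exp (F (g u)) *\<^sub>R F' (g u) - exp (F (g v)) *\<^sub>R F' (g v)) (g u - g v)
             \<ge> 2 * \<mu> * (norm (g v - g u))\<^sup>2"
proof (intro allI impI)
  fix u v
  assume K: "g u \<in> K" "g v \<in> K"
  define E where "E x = exp (F x) *\<^sub>R F' x" for x
  have gradient_inequality:
    "inner (E (g a)) (g b - g a) \<le> exp (F (g b)) - exp (F (g a)) - \<mu> * (norm (g b - g a))\<^sup>2"
    if "g a \<in> K" "g b \<in> K" for a b
  proof (rule strong_convexity_gradient_inequality[where G = "\<lambda>x. exp (F x)"])
    show "GDERIV (\<lambda>x. exp (F x)) (g a) :> E (g a)"
      unfolding E_def using F_diff that by (intro GDERIV_DERIV_compose DERIV_exp) auto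
  qed (use F_convex that in \<open>auto simp: strongly_exp_general_convex_def\<close>)
  have "inner (E (g u) - E (g v)) (g u - g v)
      = - inner (E (g u)) (g v - g u) - inner (E (g v)) (g u - g v)"
    by (simp add: inner_diff_left inner_diff_right)
  also have "\<dots> \<ge> 2 * \<mu> * (norm (g v - g u))\<^sup>2"
    using gradient_inequality[of u v] gradient_inequality[of v u] K
    by (simp add: norm_minus_commute[of "g u" "g v"])
  finally show "inner (exp (F (g u)) *\<^sub>R F' (g u) - exp (F (g v)) *\<^sub>R F' (g v)) (g u - g v)
      \<ge> 2 * \<mu> * (norm (g v - g u))\<^sup>2"
    by (simp add: E_def)
qed

end
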